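(* Suppose that $u_1:M_1 \to N$, $u_2: M_2\to N$ and $f: N \to N'$ are smooth maps between manifolds. Then $f$ induces a covariant functor $\mathbf{CRSE}(u_1,u_2) \to \mathbf{CRSE}(f \circ u_1,f\circ u_2)$, given on objects by $(\phi_1,\phi_2,U) \mapsto (\phi_1,\phi_2,f \circ U)$ and on morphisms by $c \mapsto c$.
   Context: Manifolds are smooth manifolds. A smooth map has constant rank if its Jacobian has the same rank at every point of the domain. For smooth maps $u_1: M_1 \to N$, $u_2: M_2 \to N$, the category $\mathbf{CRSE}(u_1,u_2)$ has as objects the triples $(\phi_1,\phi_2,U)$ where $\phi_1: M_1 \to C$ and $\phi_2: M_2 \to C$ are smooth constant rank maps into a common manifold $C$ and $U: C \to N$ is smooth with $u_1 = U \circ \phi_1$ and $u_2 = U \circ \phi_2$; a morphism $(\phi_1,\phi_2,U) \to (\phi_1',\phi_2',U')$ is a smooth map $c: C \to C'$ with $\phi_1' = c \circ \phi_1$, $\phi_2' = c \circ \phi_2$ and $U = U' \circ c$; composition of morphisms is composition of the maps $c$. *)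

theory Defs
  imports "HOL-Analysis.Analysis" "Jordan_Normal_Form.DL_Rank"
begin

section \<open>Smooth maps between open subsets of Euclidean spaces\<close>

text \<open>
  The model spaces are the library's \<open>Euclidean_space n\<close>, i.e. the sequences vanishing from
  index \<open>n\<close> on.  The dimension is thus a number rather than a type, so that one category can
  contain manifolds of all dimensions.
\<close>

definition partial_deriv :: "nat \<Rightarrow> ((nat \<Rightarrow> real) \<Rightarrow> real) \<Rightarrow> (nat \<Rightarrow> real) \<Rightarrow> real" where
  "partial_deriv j f x = deriv (\<lambda>t. f (x(j := t))) (x j)"

text \<open>\<open>ck_on n S k f\<close>: the real function \<open>f\<close> is of class \<open>C\<^sup>k\<close> on the
  open subset \<open>S\<close> of \<open>Euclidean_space n\<close>.\<close>

primrec ck_on :: "nat \<Rightarrow> (nat \<Rightarrow> real) set \<Rightarrow> nat \<Rightarrow> ((nat \<Rightarrow> real) \<Rightarrow> real) \<Rightarrow> bool" where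
  "ck_on n S 0 f \<longleftrightarrow> continuous_map (subtopology (Euclidean_space n) S) euclideanreal f"
| "ck_on n S (Suc k) f \<longleftrightarrow>
     continuous_map (subtopology (Euclidean_space n) S) euclideanreal f \<and>
     (\<forall>j<n. (\<forall>x\<in>S. (\<lambda>t. f (x(j := t))) field_differentiable at (x j)) \<and>
            ck_on n S k (partial_deriv j f))"

definition smooth_on ::
  "nat \<Rightarrow> nat \<Rightarrow> (nat \<Rightarrow> real) set \<Rightarrow> ((nat \<Rightarrow> real) \<Rightarrow> nat \<Rightarrow> real) \<Rightarrow> bool" where
  "smooth_on n m S F \<longleftrightarrow> (\<forall>i<m. \<forall>k. ck_on n S k (\<lambda>x. F x i))"

definition jacobian ::
  "nat \<Rightarrow> nat \<Rightarrow> ((nat \<Rightarrow> real) \<Rightarrow> nat \<Rightarrow> real) \<Rightarrow> (nat \<Rightarrow> real) \<Rightarrow> real mat" where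
  "jacobian n m F x = mat m n (\<lambda>(i, j). partial_deriv j (\<lambda>y. F y i) x)"


section \<open>Smooth manifolds\<close>

text \<open>A chart is a pair of its domain and its coordinate map.\<close>

type_synonym 'a chart = "'a set \<times> ('a \<Rightarrow> nat \<Rightarrow> real)"

record 'a manifold =
  mtop :: "'a topology"
  mdim :: nat
  charts :: "'a chart set"

abbreviation points :: "'a manifold \<Rightarrow> 'a set" where
  "points M \<equiv> topspace (mtop M)"

text \<open>Coordinate maps, like all maps below, are \<^const>\<open>extensional\<close>: they carry no information
  outside their domain, so that equality of HOL functions is equality of maps.\<close>

definition topological_chart :: "'a topology \<Rightarrow> nat \<Rightarrow> 'a chart \<Rightarrow> bool" where
  "topological_chart X n = (\<lambda>(U, \<kappa>).
     openin X U \<and> \<kappa> \<in> extensional U \<and>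
     embedding_map (subtopology X U) (Euclidean_space n) \<kappa> \<and>
     openin (Euclidean_space n) (\<kappa> ` U))"

definition smooth_transition :: "nat \<Rightarrow> 'a chart \<Rightarrow> 'a chart \<Rightarrow> bool" where
  "smooth_transition n = (\<lambda>(U, \<kappa>) (V, \<psi>).
     smooth_on n n (\<kappa> ` (U \<inter> V)) (\<psi> \<circ> inv_into U \<kappa>))"

definition smooth_compatible :: "nat \<Rightarrow> 'a chart \<Rightarrow> 'a chart \<Rightarrow> bool" where
  "smooth_compatible n c d \<longleftrightarrow> smooth_transition n c d \<and> smooth_transition n d c"

text \<open>The set of charts of a manifold is a maximal smooth atlas.\<close>

definition smooth_manifold :: "'a manifold \<Rightarrow> bool" where
  "smooth_manifold M \<longleftrightarrow>
     Hausdorff_space (mtop M) \<and> second_countable (mtop M) \<and>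
     (\<forall>c \<in> charts M. topological_chart (mtop M) (mdim M) c) \<and>
     (\<Union>c \<in> charts M. fst c) = points M \<and>
     (\<forall>c \<in> charts M. \<forall>d \<in> charts M. smooth_compatible (mdim M) c d) \<and>
     (\<forall>c. topological_chart (mtop M) (mdim M) c \<and>
          (\<forall>d \<in> charts M. smooth_compatible (mdim M) c d) \<longrightarrow> c \<in> charts M)"

definition smooth_map :: "'a manifold \<Rightarrow> 'b manifold \<Rightarrow> ('a \<Rightarrow> 'b) \<Rightarrow> bool" where
  "smooth_map M N h \<longleftrightarrow>
     h \<in> points M \<rightarrow>\<^sub>E points N \<and> continuous_map (mtop M) (mtop N) h \<and>
     (\<forall>(U, \<kappa>) \<in> charts M. \<forall>(V, \<psi>) \<in> charts N.
        smooth_on (mdim M) (mdim N) (\<kappa> ` (U \<inter> h -` V)) (\<psi> \<circ> h \<circ> inv_into U \<kappa>))"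

text \<open>The rank of the Jacobian at a point does not depend on the charts, so requiring the value
  \<open>r\<close> in all charts is the same as requiring it in one pair of charts around each point.\<close>

definition constant_rank :: "'a manifold \<Rightarrow> 'b manifold \<Rightarrow> ('a \<Rightarrow> 'b) \<Rightarrow> bool" where
  "constant_rank M N h \<longleftrightarrow>
     (\<exists>r. \<forall>(U, \<kappa>) \<in> charts M. \<forall>(V, \<psi>) \<in> charts N. \<forall>p \<in> U \<inter> h -` V.
        vec_space.rank (mdim N)
          (jacobian (mdim M) (mdim N) (\<psi> \<circ> h \<circ> inv_into U \<kappa>) (\<kappa> p)) = r)"


section \<open>Categories and functors\<close>

text \<open>Hom-sets of different pairs of objects need not be disjoint; hence identities, composites
  and the morphism part of a functor take the objects involved as arguments:
  \<open>Comp \<C> X Y Z g f\<close> is the composite of \<open>f : X \<rightarrow> Y\<close> and \<open>g : Y \<rightarrow> Z\<close>.\<close>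

record ('o, 'm) category =
  Obj :: "'o set"
  Hom :: "'o \<Rightarrow> 'o \<Rightarrow> 'm set"
  Ident :: "'o \<Rightarrow> 'm"
  Comp :: "'o \<Rightarrow> 'o \<Rightarrow> 'o \<Rightarrow> 'm \<Rightarrow> 'm \<Rightarrow> 'm"

definition is_category :: "('o, 'm) category \<Rightarrow> bool" where
  "is_category \<C> \<longleftrightarrow>
     (\<forall>X \<in> Obj \<C>. Ident \<C> X \<in> Hom \<C> X X) \<and>
     (\<forall>X \<in> Obj \<C>. \<forall>Y \<in> Obj \<C>. \<forall>Z \<in> Obj \<C>. \<forall>f \<in> Hom \<C> X Y. \<forall>g \<in> Hom \<C> Y Z.
        Comp \<C> X Y Z g f \<in> Hom \<C> X Z) \<and>
     (\<forall>X \<in> Obj \<C>. \<forall>Y \<in> Obj \<C>. \<forall>f \<in> Hom \<C> X Y.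
        Comp \<C> X X Y f (Ident \<C> X) = f \<and> Comp \<C> X Y Y (Ident \<C> Y) f = f) \<and>
     (\<forall>W \<in> Obj \<C>. \<forall>X \<in> Obj \<C>. \<forall>Y \<in> Obj \<C>. \<forall>Z \<in> Obj \<C>.
        \<forall>f \<in> Hom \<C> W X. \<forall>g \<in> Hom \<C> X Y. \<forall>h \<in> Hom \<C> Y Z.
          Comp \<C> W X Z (Comp \<C> X Y Z h g) f = Comp \<C> W Y Z h (Comp \<C> W X Y g f))"

definition covariant_functor ::
  "('o, 'm) category \<Rightarrow> ('p, 'n) category \<Rightarrow> ('o \<Rightarrow> 'p) \<Rightarrow> ('o \<Rightarrow> 'o \<Rightarrow> 'm \<Rightarrow> 'n) \<Rightarrow> bool" where
  "covariant_functor \<C> \<D> F\<^sub>o F\<^sub>m \<longleftrightarrow>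
     is_category \<C> \<and> is_category \<D> \<and>
     (\<forall>X \<in> Obj \<C>. F\<^sub>o X \<in> Obj \<D>) \<and>
     (\<forall>X \<in> Obj \<C>. \<forall>Y \<in> Obj \<C>. \<forall>f \<in> Hom \<C> X Y. F\<^sub>m X Y f \<in> Hom \<D> (F\<^sub>o X) (F\<^sub>o Y)) \<and>
     (\<forall>X \<in> Obj \<C>. F\<^sub>m X X (Ident \<C> X) = Ident \<D> (F\<^sub>o X)) \<and>
     (\<forall>X \<in> Obj \<C>. \<forall>Y \<in> Obj \<C>. \<forall>Z \<in> Obj \<C>. \<forall>f \<in> Hom \<C> X Y. \<forall>g \<in> Hom \<C> Y Z.
        F\<^sub>m X Z (Comp \<C> X Y Z g f) =
        Comp \<D> (F\<^sub>o X) (F\<^sub>o Y) (F\<^sub>o Z) (F\<^sub>m Y Z g) (F\<^sub>m X Y f))"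


section \<open>The category CRSE\<close>

text \<open>The manifold \<open>C\<close>, implicit in a triple \<open>(\<phi>\<^sub>1, \<phi>\<^sub>2, U)\<close> on paper, is a component of the
  object here.  It ranges over all manifolds, of any dimension, whose points belong to the type
  \<^typ>\<open>'c\<close>, which plays the role of a universe and is left arbitrary.\<close>

type_synonym ('a, 'b, 'n, 'c) crse_obj =
  "'c manifold \<times> ('a \<Rightarrow> 'c) \<times> ('b \<Rightarrow> 'c) \<times> ('c \<Rightarrow> 'n)"

definition CRSE ::
  "'a manifold \<Rightarrow> 'b manifold \<Rightarrow> 'n manifold \<Rightarrow> ('a \<Rightarrow> 'n) \<Rightarrow> ('b \<Rightarrow> 'n) \<Rightarrow>
   (('a, 'b, 'n, 'c) crse_obj, 'c \<Rightarrow> 'c) category" where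
  "CRSE M\<^sub>1 M\<^sub>2 N u\<^sub>1 u\<^sub>2 =
    \<lparr>Obj = {(C, \<phi>\<^sub>1, \<phi>\<^sub>2, U).
        smooth_manifold C \<and>
        smooth_map M\<^sub>1 C \<phi>\<^sub>1 \<and> constant_rank M\<^sub>1 C \<phi>\<^sub>1 \<and>
        smooth_map M\<^sub>2 C \<phi>\<^sub>2 \<and> constant_rank M\<^sub>2 C \<phi>\<^sub>2 \<and>
        smooth_map C N U \<and>
        u\<^sub>1 = compose (points M\<^sub>1) U \<phi>\<^sub>1 \<and> u\<^sub>2 = compose (points M\<^sub>2) U \<phi>\<^sub>2},
     Hom = (\<lambda>(C, \<phi>\<^sub>1, \<phi>\<^sub>2, U) (C', \<phi>\<^sub>1', \<phi>\<^sub>2', U').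
        {c. smooth_map C C' c \<and>
            \<phi>\<^sub>1' = compose (points M\<^sub>1) c \<phi>\<^sub>1 \<and> \<phi>\<^sub>2' = compose (points M\<^sub>2) c \<phi>\<^sub>2 \<and>
            U = compose (points C) U' c}),
     Ident = (\<lambda>(C, _). \<lambda>x\<in>points C. x),
     Comp = (\<lambda>(C, _) _ _ d c. compose (points C) d c)\<rparr>"

end

theory Submission
  imports Defs
begin

text \<open>
  The only analytic content is that a composite of smooth maps is smooth, which makes both
  \<open>CRSE\<close>s categories and \<open>f \<circ> U\<close> smooth; the rank conditions concern \<open>\<phi>\<^sub>1\<close> and \<open>\<phi>\<^sub>2\<close>,
  which the functor does not change.  In coordinates, the chain rule expresses the partial
  derivatives of a composite by sums of products of functions of class \<open>C\<^sup>k\<close>, so smoothness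
  follows by induction on the order; on manifolds, one localizes to the preimages of the charts of
  the middle manifold.
\<close>

section \<open>Functions of class \<open>C\<^sup>k\<close>\<close>

lemma openin_Euclidean_space_box:
  assumes "openin (Euclidean_space n) S" and "p \<in> S"
  obtains e where "e > 0"
    and "\<And>y. y \<in> topspace (Euclidean_space n) \<Longrightarrow> (\<And>i. i < n \<Longrightarrow> \<bar>y i - p i\<bar> < e) \<Longrightarrow> y \<in> S"
proof -
  obtain A where A: "openin (powertop_real UNIV) A" "S = A \<inter> {x. \<forall>i\<ge>n. x i = 0}"
    using assms(1) unfolding Euclidean_space_def openin_subtopology by blast
  have "p \<in> A" using A assms(2) by blast
  with A(1) obtain U where U: "\<forall>i\<in>UNIV. openin euclideanreal (U i)" "p \<in> Pi\<^sub>E UNIV U" "Pi\<^sub>E UNIV U \<subseteq> A"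
    unfolding openin_product_topology_alt by blast
  have "\<exists>e>0. \<forall>y. \<bar>y - p i\<bar> < e \<longrightarrow> y \<in> U i" for i
  proof -
    have "open (U i)" "p i \<in> U i" using U(1,2) by auto
    then show ?thesis unfolding open_dist dist_real_def by blast
  qed
  then obtain e where e: "\<And>i. e i > 0" "\<And>i y. \<bar>y - p i\<bar> < e i \<Longrightarrow> y \<in> U i"
    by metis
  \<comment> \<open>Both points vanish from index \<open>n\<close> on, so only the first
    \<open>n\<close> radii matter and a minimum exists; the inserted 1 keeps the set nonempty when
    \<open>n = 0\<close>.\<close>
  define d where "d = Min (insert 1 (e ` {..<n}))"
  have d: "d > 0" "\<And>i. i < n \<Longrightarrow> d \<le> e i"
    using e(1) by (auto simp: d_def)
  show thesis
  proof
    show "d > 0" by (rule d)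
    fix y assume y: "y \<in> topspace (Euclidean_space n)" "\<And>i. i < n \<Longrightarrow> \<bar>y i - p i\<bar> < d"
    have "y i \<in> U i" for i
    proof (cases "i < n")
      case True
      then show ?thesis using y(2)[OF True] d(2)[OF True] e(2)[of "y i" i] by linarith
    next
      case False
      then have "y i = p i" using y(1) assms(2) A by (auto simp: topspace_Euclidean_space)
      then show ?thesis using e(1)[of i] e(2)[of "y i" i] by simp
    qed
    then show "y \<in> S" using U(3) y(1) A(2) by (auto simp: topspace_Euclidean_space)
  qed
qed

text \<open>Passes from abstract topologies to continuity on sets of sequences: \<open>S\<close>
  lies in the subspace of sequences vanishing from \<open>n\<close> on, so the nested subtopology is
  that of \<open>S\<close> in the product topology, which is the standard one on functions.\<close>

lemma continuous_map_open_Euclidean_space: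
  assumes "openin (Euclidean_space n) S"
  shows "continuous_map (subtopology (Euclidean_space n) S) euclideanreal f \<longleftrightarrow> continuous_on S f"
proof -
  have "{x. \<forall>i\<ge>n. x i = 0} \<inter> S = S"
    using openin_subset[OF assms] by (auto simp: topspace_Euclidean_space)
  then show ?thesis
    by (simp add: Euclidean_space_def euclidean_product_topology subtopology_subtopology)
qed

lemma fun_upd_in_Euclidean_space:
  assumes "x \<in> topspace (Euclidean_space n)" and "j < n"
  shows "x(j := t) \<in> topspace (Euclidean_space n)"
  using assms by (auto simp: topspace_Euclidean_space)

lemma eventually_fun_upd_in_open:
  assumes "openin (Euclidean_space n) S" and "x \<in> S" and "j < n"
  shows "\<forall>\<^sub>F t in nhds (x j). x(j := t) \<in> S"
proof -
  obtain e where e: "e > 0"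
    "\<And>y. y \<in> topspace (Euclidean_space n) \<Longrightarrow> (\<And>i. i < n \<Longrightarrow> \<bar>y i - x i\<bar> < e) \<Longrightarrow> y \<in> S"
    using openin_Euclidean_space_box[OF assms(1,2)] by blast
  have "x \<in> topspace (Euclidean_space n)" using openin_subset[OF assms(1)] assms(2) by blast
  then have "x(j := t) \<in> S" if "dist t (x j) < e" for t
    using that e(1) assms(3)
    by (intro e(2) fun_upd_in_Euclidean_space) (auto simp: dist_real_def)
  then show ?thesis using e(1) unfolding eventually_nhds_metric by blast
qed

text \<open>Partial derivatives at points of an open \<open>S\<close> depend only on the values on
  \<open>S\<close>: near \<open>x j\<close> the coordinate line through \<open>x\<close> stays in
  \<open>S\<close>.\<close>

lemma eventually_eq_along_coordinate:
  assumes "openin (Euclidean_space n) S" and "x \<in> S" and "j < n" and "\<And>y. y \<in> S \<Longrightarrow> f y = g y"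
  shows "\<forall>\<^sub>F t in nhds (x j). f (x(j := t)) = g (x(j := t))"
  using eventually_fun_upd_in_open[OF assms(1-3)] by eventually_elim (rule assms(4))

section \<open>Monotonicity, congruence and locality of the class C^k\<close>

lemma ck_on_continuous_map:
  "ck_on n S k f \<Longrightarrow> continuous_map (subtopology (Euclidean_space n) S) euclideanreal f"
  by (cases k) auto

lemma ck_on_SucD: "ck_on n S (Suc k) f \<Longrightarrow> ck_on n S k f"
proof (induction k arbitrary: f)
  case (Suc k)
  then show ?case by (metis ck_on.simps(2))
qed auto

lemma ck_on_subset: "ck_on n S k f \<Longrightarrow> T \<subseteq> S \<Longrightarrow> ck_on n T k f"
proof (induction k arbitrary: f)
  case 0
  then show ?case by (auto intro: continuous_map_from_subtopology_mono)
next
  case (Suc k)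
  then show ?case by (auto intro: continuous_map_from_subtopology_mono)
qed

text \<open>Needed because \<open>partial_deriv\<close> is taken of total functions, while the rules
  for sums, products and composites hold only on \<open>S\<close>. Openness of \<open>S\<close>
  makes the derivatives of \<open>f\<close> and \<open>g\<close> agree there.\<close>

lemma ck_on_cong:
  assumes "openin (Euclidean_space n) S"
  shows "ck_on n S k f \<Longrightarrow> (\<And>x. x \<in> S \<Longrightarrow> f x = g x) \<Longrightarrow> ck_on n S k g"
proof (induction k arbitrary: f g)
  case 0
  then show ?case
    by (auto simp: continuous_map_open_Euclidean_space[OF assms] cong: continuous_on_cong)
next
  case (Suc k)
  have ev: "\<forall>\<^sub>F t in nhds (x j). f (x(j := t)) = g (x(j := t))" if "j < n" "x \<in> S" for j x
    using eventually_eq_along_coordinate[OF assms that(2,1)] Suc.prems(2) by blast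
  have "continuous_map (subtopology (Euclidean_space n) S) euclideanreal g"
    using Suc.prems by (auto simp: continuous_map_open_Euclidean_space[OF assms] cong: continuous_on_cong)
  moreover have "(\<lambda>t. g (x(j := t))) field_differentiable at (x j)" if "j < n" "x \<in> S" for j x
    using Suc.prems(1) that unfolding ck_on.simps field_differentiable_def
    by (simp flip: DERIV_cong_ev[OF refl ev[OF that] refl])
  moreover have "ck_on n S k (partial_deriv j g)" if "j < n" for j
  proof (rule Suc.IH)
    show "ck_on n S k (partial_deriv j f)" using Suc.prems(1) that by simp
    show "partial_deriv j f x = partial_deriv j g x" if "x \<in> S" for x
      unfolding partial_deriv_def by (intro deriv_cong_ev ev that \<open>j < n\<close> refl)
  qed
  ultimately show ?case by simp
qed

text \<open>Continuity and differentiability are tested point by point, and each point has an open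
  neighbourhood inside \<open>S\<close>; the induction carries this to the partial derivatives, with
  the same neighbourhoods.\<close>

lemma ck_on_local:
  assumes "\<And>x. x \<in> S \<Longrightarrow> \<exists>T. openin (Euclidean_space n) T \<and> x \<in> T \<and> T \<subseteq> S \<and> ck_on n T k f"
  shows "ck_on n S k f"
proof -
  have cont: "continuous_map (subtopology (Euclidean_space n) S) euclideanreal h"
    if *: "\<And>x. x \<in> S \<Longrightarrow> \<exists>T. openin (Euclidean_space n) T \<and> x \<in> T \<and> T \<subseteq> S \<and>
      continuous_map (subtopology (Euclidean_space n) T) euclideanreal h" for h
  proof -
    have "topcontinuous_at (subtopology (Euclidean_space n) S) euclideanreal h x" if x: "x \<in> S" for x
    proof -
      obtain T where T: "openin (Euclidean_space n) T" "x \<in> T" "T \<subseteq> S"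
        "continuous_map (subtopology (Euclidean_space n) T) euclideanreal h"
        using *[OF x] by blast
      have TE: "T \<subseteq> topspace (Euclidean_space n)" using T(1) openin_subset by blast
      have "\<exists>A. openin (subtopology (Euclidean_space n) S) A \<and> x \<in> A \<and> (\<forall>y\<in>A. h y \<in> V)"
        if V: "open V" "h x \<in> V" for V
      proof (intro exI conjI)
        \<comment> \<open>The preimage of \<open>V\<close> within \<open>T\<close> is open in
          \<open>T\<close>, hence in the whole space because \<open>T\<close> is open, hence also
          relative to \<open>S\<close>.\<close>
        let ?A = "{y \<in> topspace (subtopology (Euclidean_space n) T). h y \<in> V}"
        have "openin (subtopology (Euclidean_space n) T) ?A"
          by (rule openin_continuous_map_preimage[OF T(4)]) (simp add: V)
        then have "openin (Euclidean_space n) ?A"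
          by (metis (no_types, lifting) T(1) openin_trans_full)
        moreover have "?A \<subseteq> S" using T(3) by auto
        ultimately show "openin (subtopology (Euclidean_space n) S) ?A"
          unfolding openin_subtopology by blast
        show "x \<in> ?A" using T TE V by auto
        show "\<forall>y\<in>?A. h y \<in> V" by auto
      qed
      then show ?thesis using x T(2) TE by (auto simp: topcontinuous_at_def)
    qed
    then show ?thesis by (auto simp: continuous_map_eq_topcontinuous_at)
  qed
  show ?thesis
    using assms
  proof (induction k arbitrary: f)
    case 0
    then show ?case using cont[of f] by simp
  next
    case (Suc k)
    have "continuous_map (subtopology (Euclidean_space n) S) euclideanreal f"
      by (rule cont) (meson Suc.prems ck_on_continuous_map)
    moreover have "(\<lambda>t. f (x(j := t))) field_differentiable at (x j)" if "j < n" "x \<in> S" for j x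
      using Suc.prems[OF that(2)] that(1) by auto
    moreover have "ck_on n S k (partial_deriv j f)" if "j < n" for j
      by (rule Suc.IH) (use Suc.prems that in fastforce)
    ultimately show ?case by simp
  qed
qed

section \<open>Constants, sums and products of functions of class C^k\<close>

lemma ck_on_const: "ck_on n S k (\<lambda>x. c)"
proof (induction k arbitrary: c)
  case (Suc k)
  have "partial_deriv j (\<lambda>x. c) = (\<lambda>x. 0)" for j by (simp add: partial_deriv_def fun_eq_iff)
  then show ?case using Suc by simp
qed auto

context
  fixes n S
  assumes S: "openin (Euclidean_space n) S"
begin

lemma ck_on_add: "ck_on n S k f \<Longrightarrow> ck_on n S k g \<Longrightarrow> ck_on n S k (\<lambda>x. f x + g x)"
proof (induction k arbitrary: f g)
  case 0
  then show ?case by (auto intro: continuous_map_add)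
next
  case (Suc k)
  have "ck_on n S k (partial_deriv j (\<lambda>x. f x + g x))" if "j < n" for j
  proof (rule ck_on_cong[OF S])
    show "ck_on n S k (\<lambda>x. partial_deriv j f x + partial_deriv j g x)"
      using Suc that by auto
    show "partial_deriv j f x + partial_deriv j g x = partial_deriv j (\<lambda>x. f x + g x) x" if "x \<in> S" for x
      using Suc.prems that \<open>j < n\<close> by (simp add: partial_deriv_def deriv_add)
  qed
  then show ?case
    using Suc.prems unfolding ck_on.simps
    by (intro conjI allI impI ballI continuous_map_add field_differentiable_add) blast+
qed

text \<open>By the Leibniz rule each partial derivative is a sum of products of functions of class
  C^k, because a factor of class C^(k+1) is also of class C^k.\<close>

lemma ck_on_mult: "ck_on n S k f \<Longrightarrow> ck_on n S k g \<Longrightarrow> ck_on n S k (\<lambda>x. f x * g x)"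
proof (induction k arbitrary: f g)
  case 0
  then show ?case by (auto intro: continuous_map_real_mult)
next
  case (Suc k)
  have "ck_on n S k (partial_deriv j (\<lambda>x. f x * g x))" if "j < n" for j
  proof (rule ck_on_cong[OF S])
    show "ck_on n S k (\<lambda>x. f x * partial_deriv j g x + partial_deriv j f x * g x)"
      using Suc.prems that Suc.prems[THEN ck_on_SucD] by (intro ck_on_add Suc.IH) auto
    show "f x * partial_deriv j g x + partial_deriv j f x * g x = partial_deriv j (\<lambda>x. f x * g x) x"
      if "x \<in> S" for x
      using Suc.prems that \<open>j < n\<close> by (simp add: partial_deriv_def deriv_mult)
  qed
  then show ?case
    using Suc.prems unfolding ck_on.simps
    by (intro conjI allI impI ballI continuous_map_real_mult field_differentiable_mult) blast+
qed

lemma ck_on_sum: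
  assumes "finite I"
  shows "(\<And>i. i \<in> I \<Longrightarrow> ck_on n S k (f i)) \<Longrightarrow> ck_on n S k (\<lambda>x. \<Sum>i\<in>I. f i x)"
  using assms
proof (induction I rule: finite_induct)
  case empty
  then show ?case by (simp add: ck_on_const)
next
  case (insert i I)
  then show ?case by (simp add: ck_on_add)
qed

end

section \<open>The chain rule\<close>

lemma continuous_on_Euclidean_space_box:
  fixes h :: "(nat \<Rightarrow> real) \<Rightarrow> real"
  assumes T: "openin (Euclidean_space m) T" and "continuous_on T h" and p: "p \<in> T" and \<eta>: "\<eta> > 0"
  obtains e where "e > 0"
    and "\<And>y. y \<in> topspace (Euclidean_space m) \<Longrightarrow> (\<And>i. i < m \<Longrightarrow> \<bar>y i - p i\<bar> < e) \<Longrightarrow>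
      y \<in> T \<and> \<bar>h y - h p\<bar> < \<eta>"
proof -
  let ?A = "{y \<in> topspace (subtopology (Euclidean_space m) T). h y \<in> ball (h p) \<eta>}"
  have "continuous_map (subtopology (Euclidean_space m) T) euclideanreal h"
    using assms by (simp add: continuous_map_open_Euclidean_space)
  then have "openin (subtopology (Euclidean_space m) T) ?A"
    by (rule openin_continuous_map_preimage) simp
  then have A: "openin (Euclidean_space m) ?A"
    by (metis (no_types, lifting) T openin_trans_full)
  have "p \<in> ?A" using p \<eta> openin_subset[OF T] by auto
  then obtain e where "e > 0" and e: "\<And>y. y \<in> topspace (Euclidean_space m) \<Longrightarrow>
      (\<And>i. i < m \<Longrightarrow> \<bar>y i - p i\<bar> < e) \<Longrightarrow> y \<in> ?A"
    using openin_Euclidean_space_box[OF A] by blast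
  show thesis
    by (rule that[OF \<open>e > 0\<close>]) (use e in \<open>auto simp: dist_real_def abs_minus_commute\<close>)
qed

text \<open>The increments in the chain rule may have either sign or vanish. The symmetric interval
  around \<open>a\<close> contains the segment to \<open>b\<close> on either side, and for
  \<open>a = b\<close> both sides are 0.\<close>

lemma MVT_between:
  fixes f f' :: "real \<Rightarrow> real"
  assumes "\<And>x. \<bar>x - a\<bar> \<le> \<bar>b - a\<bar> \<Longrightarrow> (f has_real_derivative f' x) (at x)"
  shows "\<exists>z. \<bar>z - a\<bar> \<le> \<bar>b - a\<bar> \<and> f b - f a = (b - a) * f' z"
proof (cases a b rule: linorder_cases)
  case less
  have "\<exists>z>a. z < b \<and> f b - f a = (b - a) * f' z"
    by (rule MVT2[OF less]) (rule assms, simp)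
  then show ?thesis by force
next
  case greater
  have "\<exists>z>b. z < a \<and> f a - f b = (a - b) * f' z"
    by (rule MVT2[OF greater]) (rule assms, simp)
  then obtain z where "b < z" "z < a" "f a - f b = (a - b) * f' z" by blast
  then show ?thesis by (intro exI[of _ z]) (auto simp: algebra_simps)
qed (auto intro: exI[of _ a])

text \<open>Caratheodory's form of the derivative: at \<open>t0\<close> the factorization gives
  \<open>D t0 = 0\<close>, so the difference quotient of \<open>D\<close> is \<open>q\<close> times
  that of \<open>w\<close>, and the limits multiply.\<close>

lemma has_real_derivative_factor:
  fixes D q w :: "real \<Rightarrow> real"
  assumes "\<And>t. D t = q t * (w t - w t0)"
    and "(q \<longlongrightarrow> c) (at t0)" and "(w has_real_derivative w') (at t0)"
  shows "(D has_real_derivative c * w') (at t0)"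
proof -
  have "((\<lambda>t. q t * ((w t - w t0) / (t - t0))) \<longlongrightarrow> c * w') (at t0)"
    using assms(2,3) unfolding has_field_derivative_iff by (rule tendsto_mult)
  then show ?thesis unfolding has_field_derivative_iff by (simp add: assms(1))
qed

text \<open>The chain rule along a curve, later applied to the curve \<open>F (x(j := t))\<close>.
  Continuity of the partial derivatives takes the place of total differentiability, which
  \<open>ck_on\<close> does not state.\<close>

lemma DERIV_along_curve:
  fixes \<gamma> :: "real \<Rightarrow> nat \<Rightarrow> real"
  assumes T: "openin (Euclidean_space m) T" and g: "ck_on m T (Suc 0) g"
    and \<gamma>0: "\<gamma> t0 \<in> T" and \<gamma>: "\<forall>\<^sub>F t in nhds t0. \<gamma> t \<in> topspace (Euclidean_space m)"
    and d: "\<And>i. i < m \<Longrightarrow> ((\<lambda>t. \<gamma> t i) has_real_derivative d i) (at t0)"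
  shows "((\<lambda>t. g (\<gamma> t)) has_real_derivative (\<Sum>i<m. partial_deriv i g (\<gamma> t0) * d i)) (at t0)"
proof -
  \<comment> \<open>\<open>h k t\<close> moves from \<open>\<gamma> t0\<close> to \<open>\<gamma> t\<close> one coordinate at a time, so that each step is a
    one-variable increment to which the mean value theorem applies.\<close>
  define h where "h k t = (\<lambda>l. if l < k then \<gamma> t l else \<gamma> t0 l)" for k t
  have \<gamma>0E: "\<gamma> t0 \<in> topspace (Euclidean_space m)" using \<gamma>0 openin_subset[OF T] by blast
  have h_t0: "h k t0 = \<gamma> t0" for k by (simp add: h_def fun_eq_iff)
  have h_0: "h 0 t = \<gamma> t0" for t by (simp add: h_def)
  have h_Suc: "h (Suc k) t = (h k t)(k := \<gamma> t k)" for k t by (auto simp: h_def fun_eq_iff)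
  have h_k: "h k t k = \<gamma> t0 k" for k t by (simp add: h_def)
  \<comment> \<open>For \<open>k \<le> m\<close> only coordinates below \<open>m\<close> come from
    \<open>\<gamma> t\<close>, so the intermediate points lie in the space even for those
    \<open>t\<close> at which \<open>\<gamma> t\<close> does not.\<close>
  have hE: "h k t \<in> topspace (Euclidean_space m)" if "k \<le> m" for k t
    using \<gamma>0E that by (auto simp: h_def topspace_Euclidean_space)
  have "((\<lambda>t. g (h k t)) has_real_derivative (\<Sum>i<k. partial_deriv i g (\<gamma> t0) * d i)) (at t0)"
    if "k \<le> m" for k
    using that
  proof (induction k)
    case 0
    then show ?case by (simp add: h_0)
  next
    case (Suc k)
    then have k: "k < m" by simp
    let ?c = "partial_deriv k g (\<gamma> t0)"
    define D where "D t = g (h (Suc k) t) - g (h k t)" for t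
    \<comment> \<open>Where the increment of coordinate \<open>k\<close> is 0, the quotient would be
      0 by convention; the value \<open>?c\<close> is chosen instead so that \<open>q\<close> still
      tends to \<open>?c\<close>.\<close>
    define q where "q t = (if \<gamma> t k = \<gamma> t0 k then ?c else D t / (\<gamma> t k - \<gamma> t0 k))" for t
    have cont: "continuous_on T (partial_deriv k g)"
      using g k T by (auto simp: continuous_map_open_Euclidean_space)
    have "(q \<longlongrightarrow> ?c) (at t0)"
    proof (rule tendstoI)
      fix \<eta> :: real assume "\<eta> > 0"
      then obtain e where e: "e > 0" "\<And>y. y \<in> topspace (Euclidean_space m) \<Longrightarrow>
          (\<And>i. i < m \<Longrightarrow> \<bar>y i - \<gamma> t0 i\<bar> < e) \<Longrightarrow> y \<in> T \<and> \<bar>partial_deriv k g y - ?c\<bar> < \<eta>"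
        using continuous_on_Euclidean_space_box[OF T cont \<gamma>0] by metis
      have "\<forall>\<^sub>F t in at t0. \<forall>i\<in>{..<m}. dist (\<gamma> t i) (\<gamma> t0 i) < e"
        using DERIV_isCont[OF d] e(1)
        by (intro eventually_ball_finite ballI tendstoD) (auto simp: isCont_def)
      then show "\<forall>\<^sub>F t in at t0. dist (q t) ?c < \<eta>"
      proof eventually_elim
        case (elim t)
        \<comment> \<open>Coordinates below \<open>k\<close> are those of \<open>\<gamma> t\<close>,
          those above are those of \<open>\<gamma> t0\<close>, and \<open>s\<close> is no further
          from \<open>\<gamma> t0 k\<close> than \<open>\<gamma> t k\<close> is; so the whole
          segment of this step stays in the box.\<close>
        have box: "(h k t)(k := s) \<in> T \<and> \<bar>partial_deriv k g ((h k t)(k := s)) - ?c\<bar> < \<eta>"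
          if "\<bar>s - \<gamma> t0 k\<bar> \<le> \<bar>\<gamma> t k - \<gamma> t0 k\<bar>" for s
        proof (rule e(2))
          show "(h k t)(k := s) \<in> topspace (Euclidean_space m)"
            using k hE by (intro fun_upd_in_Euclidean_space) auto
          show "\<bar>((h k t)(k := s)) i - \<gamma> t0 i\<bar> < e" if "i < m" for i
          proof -
            have *: "\<bar>\<gamma> t i - \<gamma> t0 i\<bar> < e" "\<bar>\<gamma> t k - \<gamma> t0 k\<bar> < e"
              using elim that k by (auto simp: dist_real_def)
            show ?thesis
              using * e(1) \<open>\<bar>s - \<gamma> t0 k\<bar> \<le> \<bar>\<gamma> t k - \<gamma> t0 k\<bar>\<close> by (auto simp: h_def)
          qed
        qed
        have "((\<lambda>s. g ((h k t)(k := s))) has_real_derivative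
            partial_deriv k g ((h k t)(k := s))) (at s)"
          if "\<bar>s - \<gamma> t0 k\<bar> \<le> \<bar>\<gamma> t k - \<gamma> t0 k\<bar>" for s
        proof -
          have "(\<lambda>r. g (((h k t)(k := s))(k := r))) field_differentiable at (((h k t)(k := s)) k)"
            using g k box[OF that] unfolding ck_on.simps by blast
          then show ?thesis
            by (simp add: partial_deriv_def DERIV_deriv_iff_field_differentiable)
        qed
        from MVT_between[of "\<gamma> t0 k" "\<gamma> t k", OF this]
        obtain z where z: "\<bar>z - \<gamma> t0 k\<bar> \<le> \<bar>\<gamma> t k - \<gamma> t0 k\<bar>"
          "g ((h k t)(k := \<gamma> t k)) - g ((h k t)(k := \<gamma> t0 k)) =
            (\<gamma> t k - \<gamma> t0 k) * partial_deriv k g ((h k t)(k := z))"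
          by blast
        have "(h k t)(k := \<gamma> t0 k) = h k t" using h_k fun_upd_triv by metis
        then have "D t = (\<gamma> t k - \<gamma> t0 k) * partial_deriv k g ((h k t)(k := z))"
          using z(2) by (simp add: D_def h_Suc)
        then show ?case
          using box[OF z(1)] \<open>\<eta> > 0\<close> by (auto simp: q_def dist_real_def)
      qed
    qed
    moreover have "D t = q t * (\<gamma> t k - \<gamma> t0 k)" for t
    proof (cases "\<gamma> t k = \<gamma> t0 k")
      case True
      then have "h (Suc k) t = h k t" using h_k[of k t] fun_upd_triv h_Suc by metis
      then show ?thesis using True by (simp add: D_def)
    qed (simp add: q_def)
    ultimately have "(D has_real_derivative ?c * d k) (at t0)"
      using d[OF k] by (intro has_real_derivative_factor[where q = q])
    moreover have "((\<lambda>t. g (h k t)) has_real_derivative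
        (\<Sum>i<k. partial_deriv i g (\<gamma> t0) * d i)) (at t0)"
      using Suc by simp
    ultimately have "((\<lambda>t. g (h k t) + D t) has_real_derivative
        (\<Sum>i<k. partial_deriv i g (\<gamma> t0) * d i) + ?c * d k) (at t0)"
      by (intro DERIV_add)
    then show ?case by (simp add: D_def)
  qed
  from this[OF order_refl]
  have *: "((\<lambda>t. g (h m t)) has_real_derivative (\<Sum>i<m. partial_deriv i g (\<gamma> t0) * d i)) (at t0)" .
  \<comment> \<open>The two points share the first \<open>m\<close> coordinates, and the remaining
    ones vanish as soon as \<open>\<gamma> t\<close> lies in the space, which is known only near
    \<open>t0\<close>.\<close>
  have "\<forall>\<^sub>F t in nhds t0. g (h m t) = g (\<gamma> t)"
    using \<gamma>
  proof eventually_elim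
    case (elim t)
    then have "h m t = \<gamma> t" using \<gamma>0E by (auto simp: h_def topspace_Euclidean_space fun_eq_iff)
    then show ?case by simp
  qed
  from DERIV_cong_ev[OF refl this refl] * show ?thesis by blast
qed

section \<open>Composites of functions of class C^k\<close>

lemma continuous_map_ck_on_compose:
  assumes S: "openin (Euclidean_space n) S" and T: "openin (Euclidean_space m) T"
    and F: "\<And>x. x \<in> S \<Longrightarrow> F x \<in> T"
    and Fi: "\<And>i. i < m \<Longrightarrow> ck_on n S k (\<lambda>x. F x i)" and g: "ck_on m T k g"
  shows "continuous_map (subtopology (Euclidean_space n) S) euclideanreal (\<lambda>x. g (F x))"
proof -
  have "continuous_on S (\<lambda>x. F x i)" for i
  proof (cases "i < m")
    case True
    then show ?thesis
      using ck_on_continuous_map[OF Fi] S by (simp add: continuous_map_open_Euclidean_space)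
  next
    case False
    \<comment> \<open>Continuity of \<open>F\<close> into the product of all coordinates also needs
      the indices from \<open>m\<close> on, where \<open>F\<close> vanishes because its values lie
      in \<open>T\<close>.\<close>
    then have "F x i = 0" if "x \<in> S" for x
      using F[OF that] openin_subset[OF T] by (auto simp: topspace_Euclidean_space)
    then show ?thesis by (simp cong: continuous_on_cong)
  qed
  then have "continuous_on S F" by (rule continuous_on_coordinatewise_then_product)
  moreover have "continuous_on T g"
    using ck_on_continuous_map[OF g] T by (simp add: continuous_map_open_Euclidean_space)
  ultimately have "continuous_on S (\<lambda>x. g (F x))"
    using F by (intro continuous_on_compose2[of T g S F]) auto
  then show ?thesis using S by (simp add: continuous_map_open_Euclidean_space)
qed

text \<open>The induction varies \<open>g\<close> and keeps \<open>F\<close>: by the chain rule the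
  derivatives of the composite are sums of products of a partial derivative of \<open>g\<close>
  composed with \<open>F\<close>, covered by the induction hypothesis, and a partial derivative of a
  component of \<open>F\<close>.\<close>

lemma ck_on_compose:
  assumes S: "openin (Euclidean_space n) S" and T: "openin (Euclidean_space m) T"
    and F: "\<And>x. x \<in> S \<Longrightarrow> F x \<in> T"
  shows "(\<And>i. i < m \<Longrightarrow> ck_on n S k (\<lambda>x. F x i)) \<Longrightarrow> ck_on m T k g \<Longrightarrow> ck_on n S k (\<lambda>x. g (F x))"
proof (induction k arbitrary: g)
  case 0
  then show ?case
    unfolding ck_on.simps(1) using continuous_map_ck_on_compose[OF S T F, where k = 0 and g = g] by simp
next
  case (Suc k)
  have FS: "ck_on n S k (\<lambda>x. F x i)" if "i < m" for i
    using Suc.prems(1)[OF that] by (rule ck_on_SucD)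
  have chain: "((\<lambda>t. g (F (x(j := t)))) has_real_derivative
      (\<Sum>i<m. partial_deriv i g (F x) * partial_deriv j (\<lambda>y. F y i) x)) (at (x j))"
    if x: "x \<in> S" and j: "j < n" for x j
  proof -
    \<comment> \<open>The trivial update keeps the base point in the form \<open>\<gamma> t0\<close>
      for the curve \<open>F (x(j := t))\<close>; it simplifies away afterwards.\<close>
    have "((\<lambda>t. g (F (x(j := t)))) has_real_derivative
        (\<Sum>i<m. partial_deriv i g (F (x(j := x j))) * partial_deriv j (\<lambda>y. F y i) x)) (at (x j))"
    proof (rule DERIV_along_curve[OF T])
      show "ck_on m T (Suc 0) g"
        using Suc.prems(2) ck_on_continuous_map by auto
      show "F (x(j := x j)) \<in> T" using F[OF x] by simp
      show "\<forall>\<^sub>F t in nhds (x j). F (x(j := t)) \<in> topspace (Euclidean_space m)"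
        using eventually_fun_upd_in_open[OF S x j]
        by eventually_elim (use F openin_subset[OF T] in blast)
      show "((\<lambda>t. F (x(j := t)) i) has_real_derivative partial_deriv j (\<lambda>y. F y i) x) (at (x j))"
        if "i < m" for i
        using Suc.prems(1)[OF that] x j
        by (simp add: partial_deriv_def DERIV_deriv_iff_field_differentiable)
    qed
    then show ?thesis by simp
  qed
  have "ck_on n S k (partial_deriv j (\<lambda>x. g (F x)))" if j: "j < n" for j
  proof (rule ck_on_cong[OF S])
    show "ck_on n S k (\<lambda>x. \<Sum>i<m. partial_deriv i g (F x) * partial_deriv j (\<lambda>y. F y i) x)"
    proof (intro ck_on_sum[OF S] ck_on_mult[OF S] finite_lessThan)
      fix i assume "i \<in> {..<m}"
      then have i: "i < m" by simp
      have "ck_on m T k (partial_deriv i g)" using Suc.prems(2) i by simp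
      then show "ck_on n S k (\<lambda>x. partial_deriv i g (F x))" by (rule Suc.IH[rotated]) (rule FS)
      show "ck_on n S k (partial_deriv j (\<lambda>y. F y i))" using Suc.prems(1)[OF i] j by simp
    qed
    show "(\<Sum>i<m. partial_deriv i g (F x) * partial_deriv j (\<lambda>y. F y i) x) =
        partial_deriv j (\<lambda>x. g (F x)) x" if "x \<in> S" for x
      using DERIV_imp_deriv[OF chain[OF that j]] by (simp add: partial_deriv_def)
  qed
  moreover have "(\<lambda>t. g (F (x(j := t)))) field_differentiable at (x j)" if "j < n" "x \<in> S" for x j
    using chain[OF that(2,1)] unfolding field_differentiable_def by blast
  ultimately show ?case
    using continuous_map_ck_on_compose[OF S T F Suc.prems] by simp
qed

section \<open>Smooth maps between manifolds\<close>

lemma topological_chart_inj_on: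
  assumes "topological_chart X n (U, \<kappa>)"
  shows "inj_on \<kappa> U"
proof -
  have "openin X U" and "embedding_map (subtopology X U) (Euclidean_space n) \<kappa>"
    using assms by (auto simp: topological_chart_def)
  then show ?thesis
    unfolding embedding_map_def
    by (metis homeomorphic_imp_injective_map openin_subset topspace_subtopology_subset)
qed

text \<open>Supplies the open coordinate domains that the results on \<open>ck_on\<close> require: a
  chart is a homeomorphism onto its image, and that image is open.\<close>

lemma topological_chart_openin_image:
  assumes "topological_chart X n (U, \<kappa>)" and "openin X W" and "W \<subseteq> U"
  shows "openin (Euclidean_space n) (\<kappa> ` W)"
proof -
  have U: "openin X U" "embedding_map (subtopology X U) (Euclidean_space n) \<kappa>"
    "openin (Euclidean_space n) (\<kappa> ` U)"
    using assms(1) by (auto simp: topological_chart_def)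
  have "topspace (subtopology X U) = U" using openin_subset[OF U(1)] by auto
  then have "homeomorphic_map (subtopology X U) (subtopology (Euclidean_space n) (\<kappa> ` U)) \<kappa>"
    using U(2) by (simp add: embedding_map_def)
  moreover have "openin (subtopology X U) W"
    using assms(2,3) U(1) by (simp add: openin_open_subtopology)
  ultimately have "openin (subtopology (Euclidean_space n) (\<kappa> ` U)) (\<kappa> ` W)"
    using homeomorphic_imp_open_map open_map_def by blast
  then show ?thesis using U(3) openin_trans_full by blast
qed

lemma smooth_manifold_chartD:
  assumes "smooth_manifold M" and "(U, \<kappa>) \<in> charts M"
  shows "topological_chart (mtop M) (mdim M) (U, \<kappa>)" and "openin (mtop M) U" and "U \<subseteq> points M"
proof -
  show *: "topological_chart (mtop M) (mdim M) (U, \<kappa>)"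
    using assms unfolding smooth_manifold_def by blast
  then show "openin (mtop M) U" by (simp add: topological_chart_def)
  then show "U \<subseteq> points M" by (rule openin_subset)
qed

lemma smooth_map_funcset: "smooth_map M N h \<Longrightarrow> h \<in> points M \<rightarrow>\<^sub>E points N"
  by (simp add: smooth_map_def)

lemma smooth_mapI:
  assumes "h \<in> points M \<rightarrow>\<^sub>E points N" and "continuous_map (mtop M) (mtop N) h"
    and "\<And>U \<kappa> V \<psi>. (U, \<kappa>) \<in> charts M \<Longrightarrow> (V, \<psi>) \<in> charts N \<Longrightarrow>
      smooth_on (mdim M) (mdim N) (\<kappa> ` (U \<inter> h -` V)) (\<psi> \<circ> h \<circ> inv_into U \<kappa>)"
  shows "smooth_map M N h"
  using assms unfolding smooth_map_def by blast

lemma smooth_mapD: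
  assumes "smooth_map M N h" and "(U, \<kappa>) \<in> charts M" and "(V, \<psi>) \<in> charts N"
  shows "smooth_on (mdim M) (mdim N) (\<kappa> ` (U \<inter> h -` V)) (\<psi> \<circ> h \<circ> inv_into U \<kappa>)"
  using assms unfolding smooth_map_def by blast

text \<open>In coordinates the identity is the transition map between the two charts, which is
  smooth because charts of a manifold are compatible.\<close>

lemma smooth_map_ident:
  assumes "smooth_manifold M"
  shows "smooth_map M M (\<lambda>x\<in>points M. x)"
proof (rule smooth_mapI)
  show "continuous_map (mtop M) (mtop M) (\<lambda>x\<in>points M. x)"
    by (rule continuous_map_eq[OF continuous_map_id]) simp
  fix U \<kappa> V \<psi> assume c: "(U, \<kappa>) \<in> charts M" "(V, \<psi>) \<in> charts M"
  note U = smooth_manifold_chartD[OF assms c(1)] and V = smooth_manifold_chartD[OF assms c(2)]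
  have eq: "U \<inter> (\<lambda>x\<in>points M. x) -` V = U \<inter> V" using U(3) by auto
  have "smooth_transition (mdim M) (U, \<kappa>) (V, \<psi>)"
    using assms c unfolding smooth_manifold_def smooth_compatible_def by blast
  then have sm: "smooth_on (mdim M) (mdim M) (\<kappa> ` (U \<inter> V)) (\<psi> \<circ> inv_into U \<kappa>)"
    by (simp add: smooth_transition_def)
  have "openin (Euclidean_space (mdim M)) (\<kappa> ` (U \<inter> V))"
    using U V by (intro topological_chart_openin_image[OF U(1)]) auto
  note cong = ck_on_cong[OF this]
  show "smooth_on (mdim M) (mdim M) (\<kappa> ` (U \<inter> (\<lambda>x\<in>points M. x) -` V))
      (\<psi> \<circ> (\<lambda>x\<in>points M. x) \<circ> inv_into U \<kappa>)"
    unfolding smooth_on_def eq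
  proof (intro allI impI)
    fix i k assume "i < mdim M"
    then have "ck_on (mdim M) (\<kappa> ` (U \<inter> V)) k (\<lambda>x. (\<psi> \<circ> inv_into U \<kappa>) x i)"
      using sm by (simp add: smooth_on_def)
    then show "ck_on (mdim M) (\<kappa> ` (U \<inter> V)) k
        (\<lambda>x. (\<psi> \<circ> (\<lambda>x\<in>points M. x) \<circ> inv_into U \<kappa>) x i)"
      by (rule cong) (use U in \<open>auto simp: topological_chart_inj_on\<close>)
  qed
qed simp

text \<open>A chart domain of \<open>M\<close> need not be mapped into a single chart of
  \<open>N\<close>. Around each point \<open>p\<close> a chart of \<open>N\<close> at
  \<open>h p\<close> is chosen, the composite is treated there in coordinates, and
  \<open>ck_on_local\<close> joins the pieces.\<close>

lemma smooth_map_compose: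
  assumes M: "smooth_manifold M" and N: "smooth_manifold N" and P: "smooth_manifold P"
    and h: "smooth_map M N h" and g: "smooth_map N P g"
  shows "smooth_map M P (compose (points M) g h)"
proof (rule smooth_mapI)
  have hc: "continuous_map (mtop M) (mtop N) h" and gc: "continuous_map (mtop N) (mtop P) g"
    using h g by (auto simp: smooth_map_def)
  have hN: "h x \<in> points N" if "x \<in> points M" for x using smooth_map_funcset[OF h] that by auto
  \<comment> \<open>The bare preimage may contain elements outside \<open>points M\<close>;
    intersecting with \<open>U\<close> removes them.\<close>
  have preimage: "openin (mtop M) (U \<inter> f -` V)"
    if "openin (mtop M) U" "openin Y V" "continuous_map (mtop M) Y f" for U V Y and f :: "'a \<Rightarrow> 'd"
  proof -
    have "U \<inter> f -` V = U \<inter> {x \<in> points M. f x \<in> V}" using openin_subset[OF that(1)] by auto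
    then show ?thesis
      using openin_Int[OF that(1) openin_continuous_map_preimage[OF that(3,2)]] by simp
  qed
  show "compose (points M) g h \<in> points M \<rightarrow>\<^sub>E points P"
    using smooth_map_funcset[OF h] smooth_map_funcset[OF g]
    by (auto simp: PiE_iff compose_eq)
  show "continuous_map (mtop M) (mtop P) (compose (points M) g h)"
    by (rule continuous_map_eq[OF continuous_map_compose[OF hc gc]]) (simp add: compose_eq)
  fix U \<kappa> W \<omega> assume c: "(U, \<kappa>) \<in> charts M" "(W, \<omega>) \<in> charts P"
  note U = smooth_manifold_chartD[OF M c(1)] and W = smooth_manifold_chartD[OF P c(2)]
  note \<kappa> = topological_chart_inj_on[OF U(1)]
  let ?S = "\<kappa> ` (U \<inter> compose (points M) g h -` W)"
  let ?f = "\<lambda>x. (\<omega> \<circ> compose (points M) g h \<circ> inv_into U \<kappa>) x"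
  show "smooth_on (mdim M) (mdim P) ?S ?f"
    unfolding smooth_on_def
  proof (intro allI impI ck_on_local)
    fix i k y assume i: "i < mdim P" and "y \<in> ?S"
    then obtain p where p: "p \<in> U" "compose (points M) g h p \<in> W" "y = \<kappa> p" by auto
    have "p \<in> points M" using p(1) U(3) by blast
    then have "h p \<in> points N" "g (h p) \<in> W" using p(2) hN by (auto simp: compose_eq)
    moreover have "points N = (\<Union>c\<in>charts N. fst c)" using N unfolding smooth_manifold_def by simp
    ultimately obtain V \<psi> where V\<psi>: "(V, \<psi>) \<in> charts N" and pV: "h p \<in> V" by auto
    note V = smooth_manifold_chartD[OF N V\<psi>]
    note \<psi> = topological_chart_inj_on[OF V(1)]
    \<comment> \<open>The part of the middle chart that \<open>g\<close> sends into
      \<open>W\<close>: on its image under \<open>\<psi>\<close> the coordinate form of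
      \<open>g\<close> is smooth.\<close>
    define B where "B = V \<inter> g -` W"
    have "B = V \<inter> {x \<in> points N. g x \<in> W}" using V(3) by (auto simp: B_def)
    then have B: "openin (mtop N) B" using V(2) W(2) openin_continuous_map_preimage[OF gc] by auto
    let ?T = "\<kappa> ` (U \<inter> h -` B)" and ?F = "\<psi> \<circ> h \<circ> inv_into U \<kappa>" and ?G = "\<omega> \<circ> g \<circ> inv_into V \<psi>"
    have T: "openin (Euclidean_space (mdim M)) ?T"
      using preimage[OF U(2) B hc] by (intro topological_chart_openin_image[OF U(1)]) auto
    have B': "openin (Euclidean_space (mdim N)) (\<psi> ` B)"
      using B by (intro topological_chart_openin_image[OF V(1)]) (auto simp: B_def)
    have "ck_on (mdim M) ?T k (\<lambda>x. ?G (?F x) i)"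
    proof (rule ck_on_compose[OF T B', where F = ?F and g = "\<lambda>x. ?G x i"])
      show "?F x \<in> \<psi> ` B" if "x \<in> ?T" for x using that \<kappa> by auto
      show "ck_on (mdim M) ?T k (\<lambda>x. ?F x j)" if "j < mdim N" for j
      proof (rule ck_on_subset)
        show "ck_on (mdim M) (\<kappa> ` (U \<inter> h -` V)) k (\<lambda>x. ?F x j)"
          using smooth_mapD[OF h c(1) V\<psi>] that unfolding smooth_on_def by blast
      qed (auto simp: B_def)
      show "ck_on (mdim N) (\<psi> ` B) k (\<lambda>x. ?G x i)"
        using smooth_mapD[OF g V\<psi> c(2)] i unfolding smooth_on_def B_def by blast
    qed
    \<comment> \<open>On \<open>?T\<close> the inverse of \<open>\<psi>\<close> cancels
      \<open>\<psi>\<close>, so the two coordinate forms compose to that of the composite.\<close>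
    then have "ck_on (mdim M) ?T k (\<lambda>x. ?f x i)"
    proof (rule ck_on_cong[OF T])
      fix x assume "x \<in> ?T"
      then obtain q where q: "q \<in> U" "h q \<in> V" "x = \<kappa> q" by (auto simp: B_def)
      then show "?G (?F x) i = ?f x i" using \<kappa> \<psi> U(3) by (auto simp: compose_eq subset_iff)
    qed
    moreover have "?T \<subseteq> ?S" using U(3) by (auto simp: B_def compose_eq subset_iff)
    moreover have "y \<in> ?T" using p pV \<open>g (h p) \<in> W\<close> by (auto simp: B_def)
    ultimately show "\<exists>T. openin (Euclidean_space (mdim M)) T \<and> y \<in> T \<and> T \<subseteq> ?S \<and>
        ck_on (mdim M) T k (\<lambda>x. ?f x i)"
      using T by blast
  qed
qed

text \<open>These are equalities of HOL functions because \<open>smooth_map\<close> forces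
  \<open>h\<close> to be extensional.\<close>

lemma smooth_map_compose_units:
  assumes "smooth_map M N h"
  shows "compose (points M) h (\<lambda>x\<in>points M. x) = h"
    and "compose (points M) (\<lambda>x\<in>points N. x) h = h"
  using smooth_map_funcset[OF assms] by (auto simp: PiE_iff intro: compose_Id Id_compose)

text \<open>Since \<open>h\<close> maps into \<open>points N\<close>, the restriction of the inner
  composite to \<open>points N\<close> has no effect.\<close>

lemma smooth_map_compose_assoc:
  assumes "smooth_map M N h"
  shows "compose (points M) (compose (points N) f g) h = compose (points M) f (compose (points M) g h)"
  by (rule compose_assoc[symmetric]) (use smooth_map_funcset[OF assms] in auto)

section \<open>The induced functor\<close>

text \<open>The middle manifolds of objects are smooth, so identities and composites of morphisms
  are smooth maps; their triangles commute by the unit and associativity laws of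
  \<open>compose\<close>.\<close>

lemma is_category_CRSE: "is_category (CRSE M\<^sub>1 M\<^sub>2 N u\<^sub>1 u\<^sub>2)" (is "is_category ?C")
  unfolding is_category_def
proof (intro conjI ballI)
  fix X assume X: "X \<in> Obj ?C"
  show "Ident ?C X \<in> Hom ?C X X"
    using X by (auto simp: CRSE_def smooth_map_ident smooth_map_compose_units)
  fix Y assume Y: "Y \<in> Obj ?C"
  { fix f assume f: "f \<in> Hom ?C X Y"
    show "Comp ?C X X Y f (Ident ?C X) = f" "Comp ?C X Y Y (Ident ?C Y) f = f"
      using X Y f by (auto simp: CRSE_def smooth_map_compose_units) }
  fix Z assume Z: "Z \<in> Obj ?C"
  { fix f g assume f: "f \<in> Hom ?C X Y" and g: "g \<in> Hom ?C Y Z"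
    show "Comp ?C X Y Z g f \<in> Hom ?C X Z"
      using X Y Z f g by (auto simp: CRSE_def smooth_map_compose smooth_map_compose_assoc) }
  fix W f g h assume "W \<in> Obj ?C" "f \<in> Hom ?C X Y" "g \<in> Hom ?C Y Z" "h \<in> Hom ?C Z W"
  then show "Comp ?C X Y W (Comp ?C Y Z W h g) f = Comp ?C X Z W h (Comp ?C X Y Z g f)"
    using X Y Z by (auto simp: CRSE_def smooth_map_compose_assoc)
qed

theorem proposition13:
  fixes M\<^sub>1 :: "'a manifold" and M\<^sub>2 :: "'b manifold"
    and N :: "'n manifold" and N' :: "'k manifold"
    and u\<^sub>1 :: "'a \<Rightarrow> 'n" and u\<^sub>2 :: "'b \<Rightarrow> 'n" and f :: "'n \<Rightarrow> 'k"
  assumes "smooth_manifold M\<^sub>1" and "smooth_manifold M\<^sub>2"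
    and "smooth_manifold N" and "smooth_manifold N'"
    and "smooth_map M\<^sub>1 N u\<^sub>1" and "smooth_map M\<^sub>2 N u\<^sub>2" and "smooth_map N N' f"
  shows "covariant_functor
    (CRSE M\<^sub>1 M\<^sub>2 N u\<^sub>1 u\<^sub>2 :: (('a, 'b, 'n, 'c) crse_obj, 'c \<Rightarrow> 'c) category)
    (CRSE M\<^sub>1 M\<^sub>2 N' (compose (points M\<^sub>1) f u\<^sub>1) (compose (points M\<^sub>2) f u\<^sub>2)
       :: (('a, 'b, 'k, 'c) crse_obj, 'c \<Rightarrow> 'c) category)
    (\<lambda>(C, \<phi>\<^sub>1, \<phi>\<^sub>2, U). (C, \<phi>\<^sub>1, \<phi>\<^sub>2, compose (points C) f U))
    (\<lambda>X Y c. c)"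
  unfolding covariant_functor_def
proof (intro conjI ballI is_category_CRSE)
  let ?C = "CRSE M\<^sub>1 M\<^sub>2 N u\<^sub>1 u\<^sub>2 :: (('a, 'b, 'n, 'c) crse_obj, 'c \<Rightarrow> 'c) category"
  let ?D = "CRSE M\<^sub>1 M\<^sub>2 N' (compose (points M\<^sub>1) f u\<^sub>1) (compose (points M\<^sub>2) f u\<^sub>2)
    :: (('a, 'b, 'k, 'c) crse_obj, 'c \<Rightarrow> 'c) category"
  let ?F = "\<lambda>(C, \<phi>\<^sub>1, \<phi>\<^sub>2, U). (C, \<phi>\<^sub>1, \<phi>\<^sub>2, compose (points C) f U)"
  fix X assume X: "X \<in> Obj ?C"
  \<comment> \<open>Associativity turns \<open>f\<close> after (\<open>U\<close> after
    \<open>\<phi>\<^sub>1\<close>) into (\<open>f\<close> after \<open>U\<close>) after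
    \<open>\<phi>\<^sub>1\<close>, and likewise for \<open>\<phi>\<^sub>2\<close>; the rank
    conditions carry over verbatim.\<close>
  show "?F X \<in> Obj ?D"
    using X assms by (auto simp: CRSE_def smooth_map_compose_assoc intro: smooth_map_compose)
  show "Ident ?C X = Ident ?D (?F X)"
    by (cases X) (simp add: CRSE_def)
  fix Y assume Y: "Y \<in> Obj ?C"
  { fix c assume c: "c \<in> Hom ?C X Y"
    obtain C \<phi>\<^sub>1 \<phi>\<^sub>2 U C' \<psi>\<^sub>1 \<psi>\<^sub>2 U' where XY: "X = (C, \<phi>\<^sub>1, \<phi>\<^sub>2, U)" "Y = (C', \<psi>\<^sub>1, \<psi>\<^sub>2, U')"
      using prod_cases4 by metis
    have c: "smooth_map C C' c" "\<psi>\<^sub>1 = compose (points M\<^sub>1) c \<phi>\<^sub>1"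
      "\<psi>\<^sub>2 = compose (points M\<^sub>2) c \<phi>\<^sub>2" "U = compose (points C) U' c"
      using c by (simp_all add: XY CRSE_def)
    \<comment> \<open>Only the triangle over the target changes: it is the old one followed by
      \<open>f\<close>, rebracketed.\<close>
    have "compose (points C) f U = compose (points C) (compose (points C') f U') c"
      unfolding c(4) by (rule smooth_map_compose_assoc[OF c(1), symmetric])
    then show "c \<in> Hom ?D (?F X) (?F Y)"
      using c(1-3) by (simp add: XY CRSE_def) }
  fix Z c d
  \<comment> \<open>Of the objects, \<open>Comp\<close> reads only the manifold of the source, which
    \<open>?F\<close> keeps.\<close>
  show "Comp ?C X Y Z d c = Comp ?D (?F X) (?F Y) (?F Z) d c"
    by (cases X) (simp add: CRSE_def)
qed

end
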